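(* Let $p$ be a prime with $p\equiv 3\pmod 4$. Then for $M=(3p-1)/4$ and also for $M=p-1$, $$\sum_{k=0}^{M}(-1)^k(8k+1)\frac{(\frac14)_k^3}{k!^3}\equiv 3p(-1)^{(3p-1)/4}+\frac{27p^3}{16}E_{p-3}\left(\tfrac14\right)\pmod{p^4}.$$
   Context: $(x)_k=x(x+1)\cdots(x+k-1)$ is the Pochhammer symbol, with $(x)_0=1$. The Euler polynomials $E_n(x)$ are defined by $\sum_{n\ge 0}E_n(x)\frac{t^n}{n!}=\frac{2e^{xt}}{e^t+1}$. A congruence modulo $p^4$ between rational numbers whose denominators are prime to $p$ means that the difference lies in $p^4\mathbb{Z}_p$, where $\mathbb{Z}_p$ is the ring of $p$-adic integers. *)

theory Defs
  imports
    "HOL-Computational_Algebra.Formal_Power_Series"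
    "HOL-Computational_Algebra.Primes"
begin

text \<open>
  The value \<open>E\<^sub>n(x)\<close> of the Euler polynomial, read off from the exponential generating function
  \<open>\<Sum>n. E\<^sub>n(x) t^n / n! = 2 e^(x t) / (e^t + 1)\<close>. The denominator has constant term 2 and so is
  a unit in the ring of formal power series.
\<close>

definition euler_poly :: "nat \<Rightarrow> 'a::field_char_0 \<Rightarrow> 'a" where
  "euler_poly n x = fact n * fps_nth (2 * fps_exp x / (fps_exp 1 + 1)) n"

text \<open>
  The rational numbers that are \<open>p\<close>-adic integers, i.e. the intersection of the rationals with the
  ring of \<open>p\<close>-adic integers: in lowest terms, the denominator is prime to \<open>p\<close>.
\<close>

definition padic_ints :: "nat \<Rightarrow> rat set" where
  "padic_ints p = {x. coprime (snd (quotient_of x)) (int p)}"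

text \<open>
  Congruence of rational numbers modulo \<open>p^m\<close>: the difference is \<open>p^m\<close> times a \<open>p\<close>-adic integer.
  (If a \<open>p\<close>-adic integer \<open>z\<close> has \<open>p^m z\<close> rational, then \<open>z\<close> itself is rational.)
\<close>

definition padic_cong :: "nat \<Rightarrow> nat \<Rightarrow> rat \<Rightarrow> rat \<Rightarrow> bool" where
  "padic_cong p m x y \<longleftrightarrow> (\<exists>z \<in> padic_ints p. x - y = of_nat p ^ m * z)"

end

theory Submission
  imports Defs "HOL-Number_Theory.Residues"
begin

text \<open>
  Put \<open>P\<^sub>N(a) = \<Sum>k\<le>N. (-1)^k (a + 2k) ((a)\<^sub>k / k!)^3\<close>, so that the sum in question is \<open>4 P\<^sub>M(1/4)\<close>.
  Zeilberger's method in \<open>a\<close> gives the first-order recurrence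
  \<open>P\<^sub>N(a) + P\<^sub>N(a + 1) = (-1)^N (N + 1 + 2a) ((a + 1)\<^sub>N / N!)^3\<close>.
  Take \<open>N = p - 1\<close> and \<open>n = (3p - 1)/4\<close>. Iterating \<open>n\<close> times leads from \<open>1/4\<close> to \<open>3p/4\<close>, where
  \<open>P\<^sub>N(3p/4) \<equiv> 3p/4\<close> modulo \<open>p^4\<close>, and each right-hand side on the way is divisible by \<open>p^3\<close>, hence
  is needed only modulo \<open>p\<close> after division by \<open>p^3\<close>: at \<open>x = 1/4 + i\<close> it is
  \<open>27 p^3 x^(p-3) / 32\<close>. The same iteration applied to \<open>E\<^sub>m(x) + E\<^sub>m(x + 1) = 2 x^m\<close> with
  \<open>m = p - 3\<close> produces the same alternating sum of powers, up to
  \<open>E\<^sub>m(3p/4) \<equiv> E\<^sub>m(0) = 0\<close> modulo \<open>p\<close>; for \<open>p = 3\<close> the factor 27 makes up for \<open>E\<^sub>0(0) = 1\<close>.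
  The terms with \<open>n < k < p\<close> cancel modulo \<open>p^4\<close> in pairs under \<open>k \<mapsto> p + n - k\<close>, which settles
  \<open>M = n\<close>.
\<close>

subsection \<open>Rational \<open>p\<close>-adic integers\<close>

locale rational_padic =
  fixes p :: nat
  assumes prime_p: "prime p"
begin

lemma coprime_nonzero: "coprime b (int p) \<Longrightarrow> b \<noteq> 0"
  using prime_p by (auto simp: prime_nat_iff)

text \<open>The lowest-terms denominator divides every other denominator of the same number. Closure
  under the ring operations can then be shown with arbitrary fractions.\<close>

lemma padic_ints_iff:
  "x \<in> padic_ints p \<longleftrightarrow> (\<exists>a b. coprime b (int p) \<and> x = of_int a / of_int b)"
proof
  assume "x \<in> padic_ints p"
  then show "\<exists>a b. coprime b (int p) \<and> x = of_int a / of_int b"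
    unfolding padic_ints_def using quotient_of_div[of x] by (metis mem_Collect_eq surjective_pairing)
next
  assume "\<exists>a b. coprime b (int p) \<and> x = of_int a / of_int b"
  then obtain a b where ab: "coprime b (int p)" "x = of_int a / of_int b" by blast
  obtain c d where cd: "quotient_of x = (c, d)" by fastforce
  have d: "d > 0" "x = of_int c / of_int d" "coprime c d"
    using cd quotient_of_denom_pos quotient_of_div quotient_of_coprime by blast+
  have b: "b \<noteq> 0" using ab(1) by (rule coprime_nonzero)
  have "(of_int (a * d) :: rat) = of_int (c * b)"
    using ab(2) d(1,2) b by (simp add: field_simps)
  then have "a * d = c * b" by (simp only: of_int_eq_iff)
  then have "d dvd c * b" by (metis dvd_triv_right)
  then have "d dvd b" using d(3) by (simp add: coprime_commute coprime_dvd_mult_right_iff)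
  then have "coprime d (int p)"
    using coprime_divisors[OF _ dvd_refl ab(1)] by blast
  then show "x \<in> padic_ints p" using cd by (simp add: padic_ints_def)
qed

lemma padic_ints_of_int [simp, intro]: "of_int a \<in> padic_ints p"
  by (subst padic_ints_iff, rule exI[of _ a], rule exI[of _ 1]) simp

lemma padic_ints_of_nat [simp, intro]: "of_nat a \<in> padic_ints p"
  using padic_ints_of_int[of "int a"] by simp

lemma padic_ints_numeral [simp, intro]:
  "0 \<in> padic_ints p" "1 \<in> padic_ints p" "numeral w \<in> padic_ints p"
  using padic_ints_of_int[of 0] padic_ints_of_int[of 1] padic_ints_of_int[of "numeral w"] by simp_all

lemma padic_ints_mult [intro]:
  assumes "x \<in> padic_ints p" "y \<in> padic_ints p" shows "x * y \<in> padic_ints p"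
proof -
  obtain a b c d where "coprime b (int p)" "x = of_int a / of_int b"
      "coprime d (int p)" "y = of_int c / of_int d"
    using assms unfolding padic_ints_iff by blast
  then have "coprime (b * d) (int p)" "x * y = of_int (a * c) / of_int (b * d)" by auto
  then show ?thesis unfolding padic_ints_iff by blast
qed

lemma padic_ints_uminus [intro]: "x \<in> padic_ints p \<Longrightarrow> - x \<in> padic_ints p"
  using padic_ints_mult[OF padic_ints_of_int[of "-1"]] by simp

lemma padic_ints_add [intro]:
  assumes "x \<in> padic_ints p" "y \<in> padic_ints p" shows "x + y \<in> padic_ints p"
proof -
  obtain a b c d where *: "coprime b (int p)" "x = of_int a / of_int b"
      "coprime d (int p)" "y = of_int c / of_int d"
    using assms unfolding padic_ints_iff by blast
  then have "coprime (b * d) (int p)" "x + y = of_int (a * d + c * b) / of_int (b * d)"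
    using coprime_nonzero by (auto simp: field_simps)
  then show ?thesis unfolding padic_ints_iff by blast
qed

lemma padic_ints_diff [intro]:
  "x \<in> padic_ints p \<Longrightarrow> y \<in> padic_ints p \<Longrightarrow> x - y \<in> padic_ints p"
  using padic_ints_add[of x "- y"] padic_ints_uminus[of y] by simp

lemma padic_ints_power [intro]: "x \<in> padic_ints p \<Longrightarrow> x ^ k \<in> padic_ints p"
  by (induction k) auto

lemma padic_ints_neg_one_power [simp, intro]: "(- 1) ^ k \<in> padic_ints p"
  by (intro padic_ints_power padic_ints_uminus padic_ints_numeral)

lemma padic_ints_fact [simp, intro]: "fact k \<in> padic_ints p"
  by (metis of_nat_fact padic_ints_of_nat)

lemma padic_ints_sum [intro]:
  "(\<And>i. i \<in> A \<Longrightarrow> f i \<in> padic_ints p) \<Longrightarrow> sum f A \<in> padic_ints p"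
  by (induction A rule: infinite_finite_induct) auto

lemma padic_ints_prod [intro]:
  "(\<And>i. i \<in> A \<Longrightarrow> f i \<in> padic_ints p) \<Longrightarrow> prod f A \<in> padic_ints p"
  by (induction A rule: infinite_finite_induct) auto

text \<open>The condition \<open>x \<noteq> 0\<close> is there because \<open>inverse 0 = 0\<close>
  would otherwise let 0 count as a unit.\<close>

definition padic_units :: "rat set" where
  "padic_units = {x. x \<in> padic_ints p \<and> inverse x \<in> padic_ints p \<and> x \<noteq> 0}"

lemma padic_unitsD:
  assumes "x \<in> padic_units"
  shows "x \<in> padic_ints p" "inverse x \<in> padic_ints p" "x \<noteq> 0"
  using assms by (auto simp: padic_units_def)

lemma padic_ints_divide [intro]:
  "x \<in> padic_ints p \<Longrightarrow> y \<in> padic_units \<Longrightarrow> x / y \<in> padic_ints p"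
  unfolding divide_inverse padic_units_def by blast

lemma padic_units_mult [intro]:
  "x \<in> padic_units \<Longrightarrow> y \<in> padic_units \<Longrightarrow> x * y \<in> padic_units"
  by (auto simp: padic_units_def)

lemma padic_units_power [intro]: "x \<in> padic_units \<Longrightarrow> x ^ k \<in> padic_units"
  by (auto simp: padic_units_def simp flip: power_inverse)

lemma padic_units_prod [intro]:
  "(\<And>i. i \<in> A \<Longrightarrow> f i \<in> padic_units) \<Longrightarrow> prod f A \<in> padic_units"
  by (induction A rule: infinite_finite_induct) (auto simp: padic_units_def)

lemma padic_units_of_int [intro]:
  assumes "\<not> int p dvd a" shows "of_int a \<in> padic_units"
proof -
  have c: "coprime a (int p)"
    using prime_imp_coprime[of "int p" a] assms prime_p by (simp add: coprime_commute)
  then have "inverse (of_int a) \<in> padic_ints p"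
    unfolding padic_ints_iff by (intro exI[of _ 1] exI[of _ a]) (simp add: inverse_eq_divide)
  then show ?thesis using coprime_nonzero[OF c] by (auto simp: padic_units_def)
qed

lemma padic_units_of_nat [intro]: "0 < k \<Longrightarrow> k < p \<Longrightarrow> of_nat k \<in> padic_units"
  using padic_units_of_int[of "int k"] nat_dvd_not_less[of k p] by simp

lemma padic_units_fact [intro]: "k < p \<Longrightarrow> fact k \<in> padic_units"
  using padic_units_prod[of "{1..k}" of_nat] by (force simp: fact_prod)

section \<open>Congruences modulo powers of p\<close>

lemma padic_cong_refl [simp]: "padic_cong p m x x"
  by (auto simp: padic_cong_def intro!: bexI[of _ 0])

lemma padic_cong_sym: "padic_cong p m x y \<Longrightarrow> padic_cong p m y x"
  unfolding padic_cong_def by (metis minus_diff_eq mult_minus_right padic_ints_uminus)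

lemma padic_cong_add:
  assumes "padic_cong p m x y" "padic_cong p m u v"
  shows "padic_cong p m (x + u) (y + v)"
proof -
  obtain z w where "z \<in> padic_ints p" "w \<in> padic_ints p"
      "x - y = of_nat p ^ m * z" "u - v = of_nat p ^ m * w"
    using assms unfolding padic_cong_def by blast
  then show ?thesis unfolding padic_cong_def
    by (intro bexI[of _ "z + w"]) (auto simp: algebra_simps)
qed

lemma padic_cong_trans [trans]:
  "padic_cong p m x y \<Longrightarrow> padic_cong p m y z \<Longrightarrow> padic_cong p m x z"
  using padic_cong_add[of m x y y z] by (auto simp: padic_cong_def)

lemma padic_cong_sum:
  "(\<And>i. i \<in> A \<Longrightarrow> padic_cong p m (f i) (g i)) \<Longrightarrow> padic_cong p m (sum f A) (sum g A)"
  by (induction A rule: infinite_finite_induct) (auto intro: padic_cong_add)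

lemma padic_cong_mult_left:
  assumes "c \<in> padic_ints p" "padic_cong p m x y"
  shows "padic_cong p m (c * x) (c * y)"
proof -
  obtain z where "z \<in> padic_ints p" "x - y = of_nat p ^ m * z"
    using assms(2) unfolding padic_cong_def by blast
  then show ?thesis unfolding padic_cong_def using assms(1)
    by (intro bexI[of _ "c * z"]) (auto simp: mult_ac simp flip: right_diff_distrib)
qed

text \<open>\<open>x * u - y * v = u * (x - y) + y * (u - v)\<close>, whence the integrality of
  \<open>u\<close> and \<open>y\<close>.\<close>

lemma padic_cong_mult:
  assumes "padic_cong p m x y" "padic_cong p m u v" "u \<in> padic_ints p" "y \<in> padic_ints p"
  shows "padic_cong p m (x * u) (y * v)"
  using padic_cong_mult_left[OF assms(3,1)] padic_cong_mult_left[OF assms(4,2)]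
  by (auto simp: mult.commute intro: padic_cong_trans)

lemma padic_cong_power:
  assumes "padic_cong p m x y" "x \<in> padic_ints p" "y \<in> padic_ints p"
  shows "padic_cong p m (x ^ k) (y ^ k)"
  by (induction k) (auto intro!: padic_cong_mult assms)

lemma padic_cong_prod:
  assumes "\<And>i. i \<in> A \<Longrightarrow> padic_cong p m (f i) (g i)"
    "\<And>i. i \<in> A \<Longrightarrow> f i \<in> padic_ints p" "\<And>i. i \<in> A \<Longrightarrow> g i \<in> padic_ints p"
  shows "padic_cong p m (prod f A) (prod g A)"
  using assms
  by (induction A rule: infinite_finite_induct) (auto intro!: padic_cong_mult padic_ints_prod)

lemma padic_cong_divide:
  assumes "padic_cong p m x y" "padic_cong p m u v"
    "x \<in> padic_ints p" "u \<in> padic_units" "v \<in> padic_units"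
  shows "padic_cong p m (x / u) (y / v)"
proof -
  have "padic_cong p m (inverse (u * v) * (x * v)) (inverse (u * v) * (y * u))"
  proof (rule padic_cong_mult_left)
    show "inverse (u * v) \<in> padic_ints p"
      using assms(4,5) padic_units_mult padic_unitsD(2) by blast
    have "padic_cong p m (v * x) (u * x)"
      using padic_cong_mult_left[OF assms(3) padic_cong_sym[OF assms(2)]] by (simp add: mult.commute)
    also have "padic_cong p m (u * x) (u * y)"
      using assms(1,4) padic_cong_mult_left padic_unitsD(1) by blast
    finally show "padic_cong p m (x * v) (y * u)" by (simp add: mult.commute)
  qed
  then show ?thesis using assms(4,5)[THEN padic_unitsD(3)] by (simp add: field_simps)
qed

text \<open>Main use: once a factor \<open>p^3\<close> is split off, a congruence modulo p for the
  cofactor suffices modulo \<open>p^4\<close>.\<close>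

lemma padic_cong_scale:
  "padic_cong p m x y \<Longrightarrow> padic_cong p (k + m) (of_nat p ^ k * x) (of_nat p ^ k * y)"
  unfolding padic_cong_def by (metis power_add mult.assoc right_diff_distrib)

lemma padic_cong_p_mult:
  "x \<in> padic_ints p \<Longrightarrow> padic_cong p 1 (of_nat p * x + y) y"
  by (auto simp: padic_cong_def)

lemma padic_cong_0_antisym:
  assumes "odd p" "padic_cong p m x (- x)"
  shows "padic_cong p m x 0"
proof -
  have "p > 2" using assms(1) prime_p prime_ge_2_nat[of p] by (cases "p = 2") auto
  then have "2 \<in> padic_units" using padic_units_of_nat[of 2] by simp
  then have "inverse 2 \<in> padic_ints p" by (rule padic_unitsD)
  moreover obtain z where "z \<in> padic_ints p" "x - (- x) = of_nat p ^ m * z"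
    using assms(2) unfolding padic_cong_def by blast
  ultimately show ?thesis unfolding padic_cong_def
    by (intro bexI[of _ "inverse 2 * z"] padic_ints_mult) auto
qed

text \<open>As p - 1 is even, the sign of \<open>- j\<close> disappears and Fermat's theorem for
  \<open>j\<close> applies. The hypothesis fits the points \<open>p e - j\<close> visited by the
  recurrence in \<open>a\<close>.\<close>

lemma fermat_padic:
  assumes "odd p" "x \<in> padic_ints p" "padic_cong p 1 x (- of_nat j)" "0 < j" "j < p"
  shows "padic_cong p 1 (x ^ (p - 1)) 1"
proof -
  have "padic_cong p 1 (x ^ (p - 1)) ((- of_nat j) ^ (p - 1))"
    by (rule padic_cong_power) (use assms in auto)
  also have "(- of_nat j :: rat) ^ (p - 1) = of_nat (j ^ (p - 1))"
    using assms(1) by simp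
  also have "padic_cong p 1 \<dots> 1"
  proof -
    have "[j ^ (p - 1) = 1] (mod p)"
      using fermat_theorem[OF prime_p] assms(4,5) nat_dvd_not_less by blast
    then have "[int (j ^ (p - 1)) = 1] (mod int p)"
      by (metis cong_int_iff of_nat_1)
    then obtain t where "int (j ^ (p - 1)) - 1 = int p * t"
      by (auto simp: cong_iff_dvd_diff elim: dvdE)
    then have "(of_int (int (j ^ (p - 1)) - 1) :: rat) = of_int (int p * t)" by (simp only:)
    then show ?thesis unfolding padic_cong_def by (intro bexI[of _ "of_int t"]) auto
  qed
  finally show ?thesis .
qed

end

subsection \<open>Euler polynomials\<close>

text \<open>On generating functions, \<open>e^(x t) + e^((x+1) t) = e^(x t) (e^t + 1)\<close>
  cancels the denominator.\<close>

lemma euler_poly_add: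
  "euler_poly m x + euler_poly m (x + 1) = 2 * (x :: 'a::field_char_0) ^ m"
proof -
  let ?d = "fps_exp 1 + 1 :: 'a fps"
  have d: "fps_nth ?d 0 \<noteq> 0" by simp
  have "2 * fps_exp x / ?d + 2 * fps_exp (x + 1) / ?d = 2 * fps_exp x * (?d / ?d)"
    using d by (simp add: fps_divide_unit fps_exp_add_mult algebra_simps)
  also have "?d / ?d = 1" using d by (simp add: fps_divide_unit inverse_mult_eq_1')
  finally have "fps_nth (2 * fps_exp x / ?d) m + fps_nth (2 * fps_exp (x + 1) / ?d) m
      = fps_nth (2 * fps_exp x) m"
    by (metis fps_add_nth mult.right_neutral)
  then show ?thesis
    by (simp add: euler_poly_def numeral_fps_const flip: distrib_left)
qed

text \<open>Cauchy product of the generating series at 0 with \<open>e^(x t)\<close>.\<close>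

lemma euler_poly_binomial:
  "euler_poly m (x :: 'a::field_char_0) = (\<Sum>k\<le>m. of_nat (m choose k) * euler_poly k 0 * x ^ (m - k))"
proof -
  let ?d = "fps_exp 1 + 1 :: 'a fps"
  have "2 * fps_exp x / ?d = (2 * fps_exp 0 / ?d) * fps_exp x"
    by (simp add: fps_divide_unit mult_ac)
  then have "fps_nth (2 * fps_exp x / ?d) m
      = (\<Sum>k\<le>m. fps_nth (2 * fps_exp 0 / ?d) k * (x ^ (m - k) / fact (m - k)))"
    by (simp only: fps_mult_nth fps_exp_nth atLeast0AtMost of_nat_fact)
  then show ?thesis unfolding euler_poly_def
    by (auto simp: sum_distrib_left binomial_fact field_simps intro!: sum.cong)
qed

text \<open>Composition with \<open>- fps_X\<close> replaces t by -t, and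
  \<open>2 / (e^(-t) + 1) = 2 e^t / (e^t + 1)\<close>.\<close>

lemma euler_poly_1: "euler_poly m (1 :: 'a::field_char_0) = (- 1) ^ m * euler_poly m 0"
proof -
  let ?d = "fps_exp 1 + 1 :: 'a fps"
  let ?F = "2 / ?d"
  have F: "?F * ?d = 2" by (simp add: fps_divide_unit mult.assoc inverse_mult_eq_1)
  have 2: "(2 :: 'a fps) oo - fps_X = 2" by (simp add: numeral_fps_const)
  have "(?F oo - fps_X) * (?d oo - fps_X) = (?F * ?d) oo - fps_X"
    by (rule fps_compose_mult_distrib [symmetric]) simp
  also have "\<dots> = 2" by (simp only: F 2)
  finally have "(?F oo - fps_X) * (fps_exp (- 1) + 1) = 2"
    by (simp add: fps_compose_add_distrib)
  then have "(?F oo - fps_X) * ((fps_exp (- 1) + 1) * fps_exp 1) = 2 * fps_exp 1"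
    by (simp add: mult.assoc [symmetric])
  moreover have "(fps_exp (- 1) + 1) * fps_exp 1 = ?d"
    using fps_exp_add_mult[of "-1 :: 'a" 1] by (simp add: algebra_simps)
  ultimately have "(?F oo - fps_X) * ?d = 2 * fps_exp 1" by simp
  then have "2 * fps_exp 1 / ?d = (?F oo - fps_X) * (?d * inverse ?d)"
    by (simp add: fps_divide_unit mult.assoc [symmetric])
  also have "?d * inverse ?d = 1" by (simp add: inverse_mult_eq_1')
  finally have "2 * fps_exp 1 / ?d = ?F oo - fps_X" by simp
  then show ?thesis by (simp add: euler_poly_def fps_compose_uminus')
qed

text \<open>The values at 0 and 1 are equal because m is even, and they add up to
  \<open>2 * 0^m = 0\<close>.\<close>

lemma euler_poly_0_even:
  assumes "even m" "m > 0"
  shows "euler_poly m (0 :: 'a::field_char_0) = 0"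
  using euler_poly_add[of m "0::'a"] euler_poly_1[of m, where 'a='a] assms by auto

subsection \<open>The well-poised cubic sum\<close>

text \<open>For nonzero \<open>a\<close> this is \<open>a\<close> times the truncated
  very-well-poised series 4F3 with upper parameters a, 1 + a/2, a, a, lower parameters a/2, 1, 1 and
  argument -1.\<close>

definition well_poised_cubic_sum :: "nat \<Rightarrow> 'a::field_char_0 \<Rightarrow> 'a" where
  "well_poised_cubic_sum N a
    = (\<Sum>k\<le>N. (- 1) ^ k * (a + 2 * of_nat k) * (pochhammer a k / fact k) ^ 3)"

lemma well_poised_cubic_sum_rec:
  "well_poised_cubic_sum N a + well_poised_cubic_sum N (a + 1)
    = (- 1) ^ N * (of_nat N + 1 + 2 * a) * (pochhammer (a + 1) N / fact N) ^ 3"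
proof (induction N)
  case 0
  show ?case by (simp add: well_poised_cubic_sum_def)
next
  case (Suc N)
  let ?P = "well_poised_cubic_sum :: nat \<Rightarrow> 'a \<Rightarrow> 'a"
  \<comment> \<open>The three quotients that occur are \<open>a * t\<close>,
    \<open>(a + K) * t\<close> and \<open>K * t\<close>, so the induction step becomes a polynomial
    identity in \<open>a\<close>, \<open>K\<close> and \<open>t\<close>.\<close>
  define K :: 'a where "K = of_nat N + 1"
  define v where "v = pochhammer (a + 1) N / fact N"
  define t where "t = v / K"
  have K: "K \<noteq> 0" unfolding K_def by (metis of_nat_Suc add.commute of_nat_neq_0)
  have f: "fact (Suc N) = K * fact N" by (simp add: K_def algebra_simps)
  have 1: "pochhammer a (Suc N) / fact (Suc N) = a * t"
    unfolding pochhammer_rec t_def v_def f by simp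
  have 2: "pochhammer (a + 1) (Suc N) / fact (Suc N) = (a + K) * t"
    unfolding pochhammer_rec' t_def v_def f by (simp add: K_def ac_simps)
  have nS: "of_nat (Suc N) = K" by (simp add: K_def)
  have "?P (Suc N) a + ?P (Suc N) (a + 1) = (?P N a + ?P N (a + 1)) - (- 1) ^ N *
      ((a + 2 * K) * (a * t) ^ 3 + (a + 1 + 2 * K) * ((a + K) * t) ^ 3)"
    unfolding well_poised_cubic_sum_def sum.atMost_Suc 1 2 nS by (simp add: algebra_simps)
  also have "?P N a + ?P N (a + 1) = (- 1) ^ N * (K + 2 * a) * (K * t) ^ 3"
    using Suc.IH K by (simp add: t_def flip: v_def K_def)
  also have "(- 1) ^ N * (K + 2 * a) * (K * t) ^ 3 - (- 1) ^ N *
      ((a + 2 * K) * (a * t) ^ 3 + (a + 1 + 2 * K) * ((a + K) * t) ^ 3)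
      = - ((- 1) ^ N * (K + 1 + 2 * a) * ((a + K) * t) ^ 3)"
    by (simp add: algebra_simps power3_eq_cube)
  finally show ?case unfolding 2 nS by simp
qed

text \<open>Stated for an arbitrary \<open>f\<close> because it serves both the cubic sum and the
  Euler polynomials; comparing the two outcomes gives the theorem.\<close>

lemma alternating_telescope:
  fixes f r :: "'a::comm_ring_1 \<Rightarrow> 'a"
  assumes "\<And>x. f x + f (x + 1) = r x"
  shows "f x = (\<Sum>i<n. (- 1) ^ i * r (x + of_nat i)) + (- 1) ^ n * f (x + of_nat n)"
proof (induction n)
  case (Suc n)
  have "r (x + of_nat n) = f (x + of_nat n) + f (x + of_nat (Suc n))"
    using assms[of "x + of_nat n"] by (simp add: ac_simps)
  then show ?case using Suc by (simp add: algebra_simps)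
qed simp

section \<open>Pochhammer symbols and Euler polynomials modulo powers of p\<close>

context rational_padic
begin

lemma pochhammer_padic_ints [intro]: "x \<in> padic_ints p \<Longrightarrow> pochhammer x k \<in> padic_ints p"
  unfolding pochhammer_prod by auto

lemma padic_cong_pochhammer:
  assumes "padic_cong p m x y" "x \<in> padic_ints p" "y \<in> padic_ints p"
  shows "padic_cong p m (pochhammer x k) (pochhammer y k)"
  unfolding pochhammer_prod by (rule padic_cong_prod) (use assms in \<open>auto intro: padic_cong_add\<close>)

text \<open>The factor of index \<open>m\<close> is exactly \<open>p e\<close>. Modulo p the factors
  before it are -m, ..., -1 and those after it are 1, ..., k - 1 - m; \<open>X\<close> is the
  product of all of these.\<close>

lemma pochhammer_residue:
  assumes "e \<in> padic_ints p" "m < k"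
  obtains X where "X \<in> padic_ints p"
    "pochhammer (of_nat p * e - of_nat m) k = of_nat p * (e * X)"
    "padic_cong p 1 X ((- 1) ^ m * fact m * fact (k - 1 - m))"
proof
  let ?b = "of_nat p * e - of_nat m"
  let ?X = "pochhammer ?b m * pochhammer (of_nat p * e + 1) (k - 1 - m)"
  have k: "k = m + Suc (k - 1 - m)" using assms(2) by simp
  show "?X \<in> padic_ints p"
    using assms(1) by (intro padic_ints_mult pochhammer_padic_ints padic_ints_add padic_ints_diff) auto
  show "pochhammer ?b k = of_nat p * (e * ?X)"
    by (subst k, subst pochhammer_product') (simp add: pochhammer_rec)
  have "padic_cong p 1 ?X (pochhammer (- of_nat m) m * pochhammer 1 (k - 1 - m))"
    using assms(1) padic_cong_p_mult[of e "- of_nat m"] padic_cong_p_mult[of e 1]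
    by (intro padic_cong_mult padic_cong_pochhammer) auto
  then show "padic_cong p 1 ?X ((- 1) ^ m * fact m * fact (k - 1 - m))"
    by (simp add: pochhammer_same pochhammer_fact)
qed

text \<open>\<open>(-1)^j j!\<close> is the product of -j, ..., -1, which modulo p are p - j, ..., p
  - 1: just the factors of \<open>(p - 1)!\<close> absent from \<open>(p - 1 - j)!\<close>.\<close>

lemma padic_cong_fact_complement:
  assumes "j < p"
  shows "padic_cong p 1 ((- 1) ^ j * fact j * fact (p - 1 - j)) (fact (p - 1))"
proof -
  have "padic_cong p 1 (pochhammer (- of_nat j) j) (pochhammer (of_nat (p - j)) j)"
    using padic_cong_sym[OF padic_cong_p_mult[of 1 "- of_nat j"]] assms
    by (intro padic_cong_pochhammer) (auto simp: of_nat_diff)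
  then have "padic_cong p 1 (fact (p - 1 - j) * pochhammer (- of_nat j) j)
      (fact (p - 1 - j) * pochhammer (of_nat (p - j)) j)"
    by (rule padic_cong_mult_left[OF padic_ints_fact])
  moreover have "fact (p - 1 - j) * pochhammer (of_nat (p - j)) j = (fact (p - 1) :: rat)"
    using pochhammer_product'[of "1::rat" "p - 1 - j" j] assms
    by (simp add: pochhammer_fact of_nat_diff)
  ultimately show ?thesis by (simp add: pochhammer_same mult_ac)
qed

lemma padic_cong_cubic_term:
  assumes "padic_cong p 1 c d" "padic_cong p 1 w v"
    "c \<in> padic_ints p" "d \<in> padic_ints p" "w \<in> padic_ints p" "v \<in> padic_ints p"
  shows "padic_cong p 4 (c * (of_nat p * w) ^ 3) (of_nat p ^ 3 * (d * v ^ 3))"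
proof -
  have "padic_cong p 1 (c * w ^ 3) (d * v ^ 3)"
    using assms by (intro padic_cong_mult padic_cong_power) auto
  then show ?thesis
    using padic_cong_scale[of 1 "c * w ^ 3" "d * v ^ 3" 3] by (simp add: power_mult_distrib mult_ac)
qed

text \<open>Expanding \<open>E_m(1)\<close> at 0 in \<open>E_m(0) + E_m(1) = 2 * 0^m\<close>
  expresses \<open>2 E_m(0)\<close> through values of lower index, and 2 is a unit.\<close>

lemma euler_poly_0_padic_ints:
  assumes "odd p" shows "euler_poly m 0 \<in> padic_ints p"
proof (induction m rule: less_induct)
  case (less m)
  have "p > 2" using assms prime_p prime_ge_2_nat[of p] by (cases "p = 2") auto
  then have 2: "2 \<in> padic_units" using padic_units_of_nat[of 2] by simp
  let ?s = "\<Sum>k<m. of_nat (m choose k) * (euler_poly k 0 :: rat)"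
  have "euler_poly m 1 = ?s + (euler_poly m 0 :: rat)"
    by (simp add: euler_poly_binomial[of m 1] flip: lessThan_Suc_atMost)
  then have "euler_poly m 0 = (2 * 0 ^ m - ?s) / 2"
    using euler_poly_add[of m "0::rat"] by simp
  also have "\<dots> \<in> padic_ints p" using less 2 by (intro padic_ints_divide padic_ints_diff) auto
  finally show ?case .
qed

lemma padic_cong_euler_poly:
  assumes "odd p" "padic_cong p l x y" "x \<in> padic_ints p" "y \<in> padic_ints p"
  shows "padic_cong p l (euler_poly m x) (euler_poly m y)"
  unfolding euler_poly_binomial[of m x] euler_poly_binomial[of m y]
  using assms euler_poly_0_padic_ints
  by (intro padic_cong_sum padic_cong_mult_left padic_cong_power) auto

section \<open>Units modulo p and sums antisymmetric under reflection\<close>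

lemma p_gt_2: "odd p \<Longrightarrow> p > 2"
  using prime_p prime_ge_2_nat[of p] by (cases "p = 2") auto

lemma padic_units_divide [intro]:
  "x \<in> padic_units \<Longrightarrow> y \<in> padic_units \<Longrightarrow> x / y \<in> padic_units"
  by (auto simp: padic_units_def divide_inverse)

lemma inverse_p_notin_padic_ints: "inverse (of_nat p) \<notin> padic_ints p"
proof
  assume "inverse (of_nat p) \<in> padic_ints p"
  then obtain a b where ab: "coprime b (int p)" "inverse (of_nat p) = (of_int a / of_int b :: rat)"
    unfolding padic_ints_iff by blast
  moreover have "p > 0" using prime_p by (simp add: prime_gt_0_nat)
  ultimately have "(of_int b :: rat) = of_int (a * int p)"
    using coprime_nonzero by (auto simp: field_simps)
  then have "b = a * int p" by (simp only: of_int_eq_iff)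
  then have "int p dvd 1" using ab(1) by (metis coprime_absorb_right dvd_triv_right)
  then show False using prime_p by simp
qed

text \<open>If p divided the numerator of \<open>x\<close>, then \<open>u\<close> would be p times a
  p-adic integer, and dividing by \<open>u\<close> would make 1/p integral.\<close>

lemma padic_units_cong:
  assumes "u \<in> padic_units" "x \<in> padic_ints p" "padic_cong p 1 x u"
  shows "x \<in> padic_units"
proof -
  obtain a b where ab: "coprime b (int p)" "x = of_int a / of_int b"
    using assms(2) unfolding padic_ints_iff by blast
  have b: "of_int b \<in> padic_units"
  proof (rule padic_units_of_int)
    show "\<not> int p dvd b"
      using coprime_common_divisor[OF ab(1), of "int p"] prime_p by auto
  qed
  have "\<not> int p dvd a"
  proof
    assume "int p dvd a"
    then obtain c where "a = int p * c" by (elim dvdE)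
    then have "x = of_nat p * (of_int c / of_int b)" using ab(2) by simp
    moreover obtain z where z: "z \<in> padic_ints p" "x - u = of_nat p * z"
      using assms(3) by (auto simp: padic_cong_def)
    moreover define y where "y = of_int c / of_int b - z"
    ultimately have y: "u = of_nat p * y" by (simp only: right_diff_distrib)
    have "y \<in> padic_ints p"
      unfolding y_def using b z(1) by (intro padic_ints_diff padic_ints_divide) auto
    then have "y * inverse u \<in> padic_ints p" using assms(1) padic_unitsD(2) by blast
    moreover have "y * inverse u = inverse (of_nat p)"
      using y padic_unitsD(3)[OF assms(1)] by simp
    ultimately show False using inverse_p_notin_padic_ints by simp
  qed
  then show ?thesis using ab(2) b by auto
qed

lemma padic_cong_sum_antisym:
  fixes a b :: nat
  assumes "odd p" "\<And>k. k \<in> {a..b} \<Longrightarrow> padic_cong p l (f (a + b - k)) (- f k)"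
  shows "padic_cong p l (\<Sum>k=a..b. f k) 0"
proof (rule padic_cong_0_antisym[OF assms(1)])
  have "(\<Sum>k=a..b. f k) = (\<Sum>k=a..b. f (a + b - k))"
    by (subst sum.atLeastAtMost_rev) (simp add: add.commute)
  also have "padic_cong p l \<dots> (\<Sum>k=a..b. - f k)" by (rule padic_cong_sum) (rule assms(2))
  finally show "padic_cong p l (\<Sum>k=a..b. f k) (- (\<Sum>k=a..b. f k))" by (simp add: sum_negf)
qed

lemma padic_cong_pow_3_sum_0:
  assumes "\<And>k. k \<in> A \<Longrightarrow> padic_cong p 4 (f k) (of_nat p ^ 3 * g k)"
    and "padic_cong p 1 (\<Sum>k\<in>A. g k) 0"
  shows "padic_cong p 4 (\<Sum>k\<in>A. f k) 0"
proof -
  have "padic_cong p 4 (\<Sum>k\<in>A. f k) (\<Sum>k\<in>A. of_nat p ^ 3 * g k)"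
    by (rule padic_cong_sum) (rule assms(1))
  also have "padic_cong p 4 \<dots> 0"
    using padic_cong_scale[OF assms(2), of 3] by (simp add: sum_distrib_left)
  finally show ?thesis .
qed

section \<open>The cubic sum modulo p^4\<close>

lemma pochhammer_quotient_residue:
  assumes "e \<in> padic_ints p" "m < k" "k < p"
  obtains w where "w \<in> padic_ints p"
    "pochhammer (of_nat p * e - of_nat m) k / fact k = of_nat p * w"
    "padic_cong p 1 w (e * ((- 1) ^ m * fact m * fact (k - 1 - m)) / fact k)"
proof -
  obtain X where X: "X \<in> padic_ints p"
    "pochhammer (of_nat p * e - of_nat m) k = of_nat p * (e * X)"
    "padic_cong p 1 X ((- 1) ^ m * fact m * fact (k - 1 - m))"
    using pochhammer_residue[OF assms(1,2)] by blast
  have "padic_cong p 1 (e * X / fact k) (e * ((- 1) ^ m * fact m * fact (k - 1 - m)) / fact k)"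
    using assms X by (intro padic_cong_divide padic_cong_mult_left) auto
  moreover have "e * X / fact k \<in> padic_ints p" using assms X(1) by auto
  ultimately show ?thesis using X(2) that[of "e * X / fact k"] by simp
qed

text \<open>The term k = 0 is \<open>p e\<close> itself. Each later term is \<open>p^3\<close> times
  a quantity congruent modulo p to \<open>2 (-1)^k e^3 / k^2\<close>, which changes sign under k ->
  p - k because p is odd.\<close>

lemma well_poised_cubic_sum_p_multiple:
  assumes "odd p" "e \<in> padic_ints p"
  shows "padic_cong p 4 (well_poised_cubic_sum (p - 1) (of_nat p * e)) (of_nat p * e)"
proof -
  define x where "x = of_nat p * e"
  define f where "f = (\<lambda>k. (- 1) ^ k * (x + 2 * of_nat k) * (pochhammer x k / fact k) ^ 3)"
  define g :: "nat \<Rightarrow> rat" where "g = (\<lambda>k. (- 1) ^ k * (2 * of_nat k) * (e / of_nat k) ^ 3)"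
  have x: "x \<in> padic_ints p" using assms(2) by (auto simp: x_def)
  have "{..p - 1} = insert 0 {1..p - 1}" by auto
  then have "well_poised_cubic_sum (p - 1) x = x + (\<Sum>k=1..p - 1. f k)"
    by (simp add: well_poised_cubic_sum_def f_def)
  moreover have "padic_cong p 4 (\<Sum>k=1..p - 1. f k) 0"
  proof (rule padic_cong_pow_3_sum_0)
    fix k assume k: "k \<in> {1..p - 1}"
    then have kp: "0 < k" "k < p" by auto
    obtain w where w: "w \<in> padic_ints p" "pochhammer x k / fact k = of_nat p * w"
        "padic_cong p 1 w (e * fact (k - 1) / fact k)"
      using pochhammer_quotient_residue[OF assms(2) kp] by (auto simp: x_def)
    have "e * fact (k - 1) / fact k = e / of_nat k"
      using kp by (simp add: fact_reduce field_simps)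
    then have "padic_cong p 1 w (e / of_nat k)" using w(3) by simp
    moreover have "padic_cong p 1 ((- 1) ^ k * (x + 2 * of_nat k)) ((- 1) ^ k * (2 * of_nat k))"
      unfolding x_def using assms(2) by (intro padic_cong_mult_left padic_cong_p_mult) auto
    ultimately show "padic_cong p 4 (f k) (of_nat p ^ 3 * g k)"
      unfolding f_def w(2) g_def using w(1) x kp assms(2)
      by (intro padic_cong_cubic_term) auto
  next
    show "padic_cong p 1 (\<Sum>k=1..p - 1. g k) 0"
    proof (rule padic_cong_sum_antisym[OF assms(1)])
      fix k assume k: "k \<in> {1..p - 1}"
      then have kp: "0 < k" "k < p" "0 < p - k" "p - k < p" by auto
      define q :: rat where "q = of_nat (p - k)"
      have q: "q \<in> padic_units" unfolding q_def by (rule padic_units_of_nat[OF kp(3,4)])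
      have "padic_cong p 1 q (- of_nat k)"
        using padic_cong_p_mult[of 1 "- of_nat k"] kp by (simp add: q_def of_nat_diff)
      moreover have "- of_nat k \<in> padic_units"
        using padic_units_mult[OF padic_units_of_nat[OF kp(1,2)], of "- 1"] by (auto simp: padic_units_def)
      moreover from this have "e / - of_nat k \<in> padic_ints p" using assms(2) by blast
      ultimately have "padic_cong p 1 (g (p - k)) ((- 1) ^ (p - k) * (2 * - of_nat k) * (e / - of_nat k) ^ 3)"
        unfolding g_def q_def[symmetric] using q assms(2)
        by (intro padic_cong_mult padic_cong_power padic_cong_divide padic_cong_refl)
          (auto dest: padic_unitsD)
      also have "(- 1) ^ (p - k) = - ((- 1 :: rat) ^ k)"
        using assms(1) kp by (cases "even k") auto
      also have "- ((- 1) ^ k) * (2 * - of_nat k) * (e / - of_nat k) ^ 3 = - g k"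
        by (simp add: g_def power3_eq_cube)
      finally show "padic_cong p 1 (g (1 + (p - 1) - k)) (- g k)" using kp by simp
    qed
  qed
  ultimately show ?thesis
    using padic_cong_add[of 4 x x _ 0] by (simp add: x_def)
qed

text \<open>For k > n the factor \<open>p e\<close> of index n occurs in the Pochhammer symbol, so
  each term carries \<open>p^3\<close> and only its cofactor modulo p matters.\<close>

lemma well_poised_cubic_sum_tail:
  fixes n :: nat
  assumes "odd p" "e \<in> padic_ints p"
  defines "x \<equiv> of_nat p * e - of_nat n"
  shows "padic_cong p 4
    (\<Sum>k=n+1..p - 1. (- 1) ^ k * (x + 2 * of_nat k) * (pochhammer x k / fact k) ^ 3) 0"
proof -
  \<comment> \<open>\<open>Q k\<close> is (k - n) ... k, that is \<open>k! / (k - 1 - n)!\<close>;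
    \<open>C\<close> collects the factors free of k, so that the quotient divided by p is congruent
    to \<open>C / Q k\<close>.\<close>
  define Q :: "nat \<Rightarrow> rat" where "Q = (\<lambda>k. pochhammer (of_nat (k - n)) (n + 1))"
  define C where "C = e * ((- 1) ^ n * fact n)"
  define g where "g = (\<lambda>k. (- 1) ^ k * (2 * of_nat k - of_nat n) * (C / Q k) ^ 3)"
  have x: "x \<in> padic_ints p" using assms(2) by (auto simp: x_def)
  have C: "C \<in> padic_ints p" unfolding C_def using assms(2) by auto
  have QF: "fact k = fact (k - 1 - n) * Q k" if "n < k" for k
    using pochhammer_product'[of "1::rat" "k - 1 - n" "n + 1"] that
    by (simp add: Q_def pochhammer_fact of_nat_diff)
  have Qunit: "Q k \<in> padic_units" if "n < k" "k < p" for k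
  proof -
    have "Q k = fact k / fact (k - 1 - n)" using QF[OF that(1)] by simp
    also have "\<dots> \<in> padic_units" using that by (intro padic_units_divide padic_units_fact) auto
    finally show ?thesis .
  qed
  show ?thesis
  proof (rule padic_cong_pow_3_sum_0)
    fix k assume "k \<in> {n + 1..p - 1}"
    then have k: "n < k" "k < p" by auto
    obtain w where w: "w \<in> padic_ints p" "pochhammer x k / fact k = of_nat p * w"
        "padic_cong p 1 w (e * ((- 1) ^ n * fact n * fact (k - 1 - n)) / fact k)"
      using pochhammer_quotient_residue[OF assms(2) k] by (auto simp: x_def)
    have "padic_cong p 1 w (C / Q k)" using w(3) QF[OF k(1)] by (simp add: C_def)
    moreover have "padic_cong p 1 ((- 1) ^ k * (x + 2 * of_nat k)) ((- 1) ^ k * (2 * of_nat k - of_nat n))"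
      using padic_cong_p_mult[OF assms(2), of "2 * of_nat k - of_nat n"]
      by (intro padic_cong_mult_left) (auto simp: x_def algebra_simps)
    ultimately show "padic_cong p 4 ((- 1) ^ k * (x + 2 * of_nat k) * (pochhammer x k / fact k) ^ 3)
        (of_nat p ^ 3 * g k)"
      unfolding w(2) g_def using w(1) x C Qunit[OF k]
      by (intro padic_cong_cubic_term) auto
  next
    show "padic_cong p 1 (\<Sum>k=n+1..p - 1. g k) 0"
    proof (rule padic_cong_sum_antisym[OF assms(1)])
      fix k assume "k \<in> {n + 1..p - 1}"
      then have k: "n < k" "k < p" by auto
      define k' where "k' = n + 1 + (p - 1) - k"
      have k': "n < k'" "k' < p" using k by (auto simp: k'_def)
      have kk: "of_nat k' = of_nat p + of_nat n - (of_nat k :: rat)"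
        using k by (simp add: k'_def of_nat_diff)
      \<comment> \<open>Modulo p the reflection turns the n + 1 factors of \<open>Q k\<close> into
        their negatives in reverse order; \<open>s\<close> is the resulting sign.\<close>
      define s :: rat where "s = (- 1) ^ (n + 1)"
      have s: "s * s = 1" by (simp add: s_def flip: power_add)
      have sU: "s \<in> padic_units"
        unfolding s_def by (rule padic_units_power) (auto simp: padic_units_def)
      have "padic_cong p 1 (Q k') (pochhammer (- of_nat k) (n + 1))"
        unfolding Q_def using k' padic_cong_p_mult[of 1 "- of_nat k"]
        by (intro padic_cong_pochhammer) (auto simp: kk of_nat_diff)
      also have "pochhammer (- of_nat k) (n + 1) = s * Q k"
        using k by (simp add: pochhammer_minus s_def Q_def of_nat_diff)
      finally have "padic_cong p 1 (C / Q k') (C / (s * Q k))"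
        using C sU Qunit[OF k] Qunit[OF k'] by (intro padic_cong_divide) auto
      also have "C / (s * Q k) = s * (C / Q k)"
        using s padic_unitsD(3)[OF sU] padic_unitsD(3)[OF Qunit[OF k]] by (simp add: field_simps)
      finally have "padic_cong p 1 (g k')
          ((- 1) ^ k' * - (2 * of_nat k - of_nat n) * (s * (C / Q k)) ^ 3)"
        unfolding g_def using padic_cong_p_mult[of 2 "of_nat n - 2 * of_nat k"] C sU Qunit[OF k] Qunit[OF k']
        by (intro padic_cong_mult padic_cong_power padic_cong_refl)
          (auto simp: kk algebra_simps dest: padic_unitsD)
      also have "(- 1) ^ k' = s * (- 1) ^ k"
        using assms(1) k by (cases "even k"; cases "even n") (auto simp: s_def k'_def)
      \<comment> \<open>One \<open>s\<close> comes from \<open>(-1)^k'\<close> and three from the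
        cube; as \<open>s^4 = 1\<close>, only the minus sign of \<open>2 k - n\<close>
        survives.\<close>
      also have "s * (- 1) ^ k * - (2 * of_nat k - of_nat n) * (s * (C / Q k)) ^ 3
          = (s * s) * (s * s) * - g k"
        unfolding g_def power_mult_distrib power3_eq_cube[of s] by (simp only: mult_ac mult_minus_left mult_minus_right)
      finally show "padic_cong p 1 (g (n + 1 + (p - 1) - k)) (- g k)" by (simp add: s k'_def)
    qed
  qed
qed

text \<open>The Pochhammer symbol contains \<open>p e\<close> at index j - 1, and its quotient by
  \<open>(p - 1)!\<close> is p times a number congruent to \<open>e / x\<close>. This leaves
  \<open>2 e^3 / x^2\<close>, which Fermat turns into a multiple of \<open>x^(p - 3)\<close>, the
  power in the Euler recurrence.\<close>

lemma well_poised_cubic_sum_rec_residue: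
  fixes j :: nat
  assumes "odd p" "e \<in> padic_ints p" "0 < j" "j < p"
  defines "x \<equiv> of_nat p * e - of_nat j"
  shows "padic_cong p 4 ((of_nat p + 2 * x) * (pochhammer (x + 1) (p - 1) / fact (p - 1)) ^ 3)
    (of_nat p ^ 3 * (2 * e ^ 3 * x ^ (p - 3)))"
proof -
  let ?F = "fact (p - 1) :: rat"
  have x: "x \<in> padic_ints p" using assms(2) by (auto simp: x_def)
  have F: "?F \<in> padic_units" using assms(4) by auto
  have jU: "- of_nat j \<in> padic_units"
    using padic_units_of_nat[OF assms(3,4)] padic_units_of_int[of "- int j"] assms(3,4)
    by (simp add: nat_dvd_not_less)
  have xj: "padic_cong p 1 x (- of_nat j)"
    using padic_cong_p_mult[OF assms(2), of "- of_nat j"] by (simp add: x_def)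
  have xU: "x \<in> padic_units" by (rule padic_units_cong[OF jU x xj])
  have j2: "j - 1 < p - 1" "p - 1 < p" using assms(3,4) by auto
  have j1: "of_nat p * e - of_nat (j - 1) = x + 1"
    using assms(3) by (simp add: x_def of_nat_diff)
  obtain w where w: "w \<in> padic_ints p" "pochhammer (x + 1) (p - 1) / ?F = of_nat p * w"
      "padic_cong p 1 w (e * ((- 1) ^ (j - 1) * fact (j - 1) * fact (p - 1 - 1 - (j - 1))) / ?F)"
    using pochhammer_quotient_residue[OF assms(2) j2, unfolded j1] by blast
  \<comment> \<open>Inserting the missing factor -j, which is congruent to \<open>x\<close>,
    completes the product to one congruent to \<open>(p - 1)!\<close>.\<close>
  have "(- 1) ^ (j - 1) * fact (j - 1) * fact (p - 1 - 1 - (j - 1))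
      = (- 1) ^ j * fact j * fact (p - 1 - j) / (- of_nat j :: rat)"
    using assms(3) by (cases j) (auto simp: field_simps)
  also have "padic_cong p 1 \<dots> (?F / x)"
  proof (rule padic_cong_divide[OF padic_cong_fact_complement[OF assms(4)] padic_cong_sym[OF xj] _ jU xU])
    show "(- 1) ^ j * fact j * fact (p - 1 - j) \<in> padic_ints p" by auto
  qed
  finally have "padic_cong p 1 (e * ((- 1) ^ (j - 1) * fact (j - 1) * fact (p - 1 - 1 - (j - 1))) / ?F)
      (e * (?F / x) / ?F)"
    using assms(2) F
    by (intro padic_cong_divide padic_cong_mult_left padic_ints_mult) auto
  also have "e * (?F / x) / ?F = e / x" by simp
  finally have "padic_cong p 1 w (e / x)" using w(3) padic_cong_trans by blast
  moreover have "padic_cong p 1 (of_nat p + 2 * x) (2 * x)" using padic_cong_p_mult[of 1 "2 * x"] by simp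
  ultimately have "padic_cong p 4 ((of_nat p + 2 * x) * (of_nat p * w) ^ 3) (of_nat p ^ 3 * (2 * x * (e / x) ^ 3))"
    using w(1) x xU assms(2) by (intro padic_cong_cubic_term) auto
  also have "2 * x * (e / x) ^ 3 = 2 * e ^ 3 * (1 / x ^ 2)"
    using padic_unitsD(3)[OF xU] by (simp add: field_simps power2_eq_square power3_eq_cube)
  also have "padic_cong p 4 (of_nat p ^ 3 * \<dots>) (of_nat p ^ 3 * (2 * e ^ 3 * x ^ (p - 3)))"
  proof -
    have "p - 1 = (p - 3) + 2" using p_gt_2[OF assms(1)] by simp
    then have "x ^ (p - 3) = x ^ (p - 1) / x ^ 2"
      using padic_unitsD(3)[OF xU] by (simp only: power_add) simp
    moreover have "padic_cong p 1 (1 / x ^ 2) (x ^ (p - 1) / x ^ 2)"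
      by (intro padic_cong_divide padic_cong_refl padic_cong_sym[OF fermat_padic[OF assms(1) x xj assms(3,4)]]
          padic_ints_numeral padic_units_power xU)
    ultimately have "padic_cong p 1 (2 * e ^ 3 * (1 / x ^ 2)) (2 * e ^ 3 * x ^ (p - 3))"
      using assms(2) by (intro padic_cong_mult_left) auto
    from padic_cong_scale[OF this, of 3] show ?thesis by simp
  qed
  finally show ?thesis unfolding w(2) .
qed

end

section \<open>Comparison of the cubic sum with the Euler polynomial\<close>

theorem theorem1p4:
  fixes p M :: nat
  assumes "prime p" and "p mod 4 = 3"
    and "M = (3 * p - 1) div 4 \<or> M = p - 1"
  shows "padic_cong p 4
    (\<Sum>k=0..M. (- 1) ^ k * (8 * of_nat k + 1) * pochhammer (1 / 4) k ^ 3 / fact k ^ 3)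
    (3 * of_nat p * (- 1) ^ ((3 * p - 1) div 4)
      + 27 * of_nat p ^ 3 / 16 * euler_poly (p - 3) (1 / 4))"
proof -
  interpret rational_padic p by standard (rule assms(1))
  define n where "n = (3 * p - 1) div 4"
  have n: "4 * n + 1 = 3 * p" unfolding n_def using assms(2) by presburger
  have np: "n < p" using n by simp
  have odd: "odd p" using assms(2) by presburger
  have fU: "4 \<in> padic_units"
    using padic_units_power[OF padic_units_of_nat[of 2], of 2] p_gt_2[OF odd] by simp
  \<comment> \<open>From 4n + 1 = 3p: the starting point 1/4 is \<open>p e - n\<close>, and n unit
    steps lead to \<open>p e\<close>.\<close>
  define e :: rat where "e = 3 / 4"
  have e: "e \<in> padic_ints p" using fU by (auto simp: e_def)
  have "(of_nat (4 * n + 1) :: rat) = of_nat (3 * p)" by (simp only: n)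
  then have a: "1 / 4 = of_nat p * e - of_nat n" and a': "1 / 4 + of_nat n = of_nat p * e"
    by (simp_all add: e_def)
  define t :: "nat \<Rightarrow> rat"
    where "t = (\<lambda>k. (- 1) ^ k * (1 / 4 + 2 * of_nat k) * (pochhammer (1 / 4) k / fact k) ^ 3)"
  define r :: "rat \<Rightarrow> rat"
    where "r = (\<lambda>x. (of_nat p + 2 * x) * (pochhammer (x + 1) (p - 1) / fact (p - 1)) ^ 3)"
  define H :: rat where "H = (\<Sum>i<n. (- 1) ^ i * (1 / 4 + of_nat i) ^ (p - 3))"
  let ?P = "well_poised_cubic_sum (p - 1) :: rat \<Rightarrow> rat"

  \<comment> \<open>Here N = p - 1 is even, so the sign \<open>(-1)^N\<close> is 1.\<close>
  have "?P x + ?P (x + 1) = r x" for x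
    using well_poised_cubic_sum_rec[of "p - 1" x] odd p_gt_2 by (simp add: r_def of_nat_diff)
  from alternating_telescope[of ?P, OF this, of "1 / 4" n]
  have "?P (1 / 4) = (\<Sum>i<n. (- 1) ^ i * r (1 / 4 + of_nat i)) + (- 1) ^ n * ?P (of_nat p * e)"
    by (simp only: a')
  also have "padic_cong p 4 \<dots> ((\<Sum>i<n. (- 1) ^ i * (of_nat p ^ 3 * (2 * e ^ 3 * (1 / 4 + of_nat i) ^ (p - 3))))
      + (- 1) ^ n * (of_nat p * e))"
  proof (intro padic_cong_add padic_cong_sum padic_cong_mult_left
      well_poised_cubic_sum_p_multiple odd e padic_ints_power padic_ints_uminus padic_ints_numeral)
    fix i assume "i \<in> {..<n}"
    then have i: "1 / 4 + of_nat i = of_nat p * e - of_nat (n - i)" "0 < n - i" "n - i < p"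
      using a np by (auto simp: of_nat_diff)
    show "padic_cong p 4 (r (1 / 4 + of_nat i)) (of_nat p ^ 3 * (2 * e ^ 3 * (1 / 4 + of_nat i) ^ (p - 3)))"
      unfolding r_def i(1) by (intro well_poised_cubic_sum_rec_residue odd e i(2,3))
  qed
  also have "\<dots> = 2 * e ^ 3 * of_nat p ^ 3 * H + (- 1) ^ n * (of_nat p * e)"
    by (simp add: H_def sum_distrib_left mult_ac)
  finally have P: "padic_cong p 4 (4 * ?P (1 / 4)) (4 * (2 * e ^ 3 * of_nat p ^ 3 * H + (- 1) ^ n * (of_nat p * e)))"
    by (intro padic_cong_mult_left) auto

  have "padic_cong p 1 (27 * euler_poly (p - 3) (of_nat p * e)) (27 * euler_poly (p - 3) 0)"
    using padic_cong_p_mult[OF e, of 0] odd e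
    by (intro padic_cong_mult_left padic_cong_euler_poly) auto
  also have "padic_cong p 1 (27 * euler_poly (p - 3) 0) 0"
  proof (cases "p = 3")
    case True
    then show ?thesis
      \<comment> \<open>For p = 3, 27 is written as p times 9.\<close>
      using padic_cong_p_mult[OF padic_ints_mult[OF padic_ints_of_nat[of 9] euler_poly_0_padic_ints[OF odd]],
          of 0 0] by simp
  next
    case False
    then have "euler_poly (p - 3) (0 :: rat) = 0"
      using odd p_gt_2[OF odd] by (intro euler_poly_0_even) auto
    then show ?thesis by simp
  qed
  \<comment> \<open>The factor supplies the sign of the telescoped remainder and the 16 of the
    target; \<open>p^3\<close> then lifts the congruence to \<open>p^4\<close>.\<close>
  finally have "padic_cong p 1 ((- 1) ^ n / 4 ^ 2 * (27 * euler_poly (p - 3) (of_nat p * e))) ((- 1) ^ n / 4 ^ 2 * 0)"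
    by (rule padic_cong_mult_left[rotated])
      (intro padic_ints_divide padic_units_power fU padic_ints_neg_one_power)
  from padic_cong_scale[OF this, of 3]
  have E0: "padic_cong p 4 (27 * of_nat p ^ 3 / 16 * ((- 1) ^ n * euler_poly (p - 3) (of_nat p * e))) 0"
    by (simp add: mult_ac)
  have "euler_poly (p - 3) (1 / 4) = (\<Sum>i<n. (- 1) ^ i * (2 * (1 / 4 + of_nat i) ^ (p - 3)))
      + (- 1) ^ n * euler_poly (p - 3) (of_nat p * e)"
    using alternating_telescope[of "euler_poly (p - 3)", OF euler_poly_add, of "1 / 4 :: rat" n]
    by (simp only: a')
  then have E: "euler_poly (p - 3) (1 / 4) = 2 * H + (- 1) ^ n * euler_poly (p - 3) (of_nat p * e)"
    by (simp add: H_def sum_distrib_left mult_ac)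
  have main: "padic_cong p 4 (4 * ?P (1 / 4))
      (3 * of_nat p * (- 1) ^ n + 27 * of_nat p ^ 3 / 16 * euler_poly (p - 3) (1 / 4))"
  proof -
    \<comment> \<open>The coefficients of \<open>H\<close> agree because
      \<open>8 e^3 = 27/8 = 2 * 27/16\<close>, and \<open>4 e = 3\<close> gives the linear
      term.\<close>
    have "4 * (2 * e ^ 3 * of_nat p ^ 3 * H + (- 1) ^ n * (of_nat p * e))
        + 27 * of_nat p ^ 3 / 16 * ((- 1) ^ n * euler_poly (p - 3) (of_nat p * e))
        = 3 * of_nat p * (- 1) ^ n + 27 * of_nat p ^ 3 / 16 * euler_poly (p - 3) (1 / 4)"
      unfolding E by (simp add: e_def power_divide algebra_simps)
    then show ?thesis using padic_cong_add[OF P padic_cong_sym[OF E0]] by simp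
  qed

  have PM: "padic_cong p 4 (\<Sum>k\<le>M. t k) (?P (1 / 4))"
    using assms(3)
  proof
    assume "M = p - 1"
    then show ?thesis by (simp add: well_poised_cubic_sum_def t_def)
  next
    assume "M = (3 * p - 1) div 4"
    then have M: "M = n" by (simp add: n_def)
    have "padic_cong p 4 (\<Sum>k=n+1..p - 1. t k) 0"
      using well_poised_cubic_sum_tail[OF odd e, of n] unfolding a[symmetric] t_def .
    then have "padic_cong p 4 ((\<Sum>k\<le>n. t k) + (\<Sum>k=n+1..p - 1. t k)) ((\<Sum>k\<le>n. t k) + 0)"
      by (intro padic_cong_add) auto
    moreover have "{..p - 1} = {..n} \<union> {n+1..p - 1}" using np by auto
    then have "?P (1 / 4) = (\<Sum>k\<le>n. t k) + (\<Sum>k=n+1..p - 1. t k)"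
      unfolding well_poised_cubic_sum_def t_def by (subst sum.union_disjoint[symmetric]) auto
    ultimately show ?thesis using padic_cong_sym M by simp
  qed
  have "(\<Sum>k=0..M. (- 1) ^ k * (8 * of_nat k + 1) * pochhammer (1 / 4) k ^ 3 / fact k ^ 3)
      = 4 * (\<Sum>k\<le>M. t k)"
    unfolding sum_distrib_left atLeast0AtMost t_def by (intro sum.cong) (auto simp: field_simps)
  moreover have "padic_cong p 4 (4 * (\<Sum>k\<le>M. t k)) (4 * ?P (1 / 4))"
    using PM by (intro padic_cong_mult_left) auto
  ultimately show ?thesis using padic_cong_trans[OF _ main] by (simp add: n_def)
qed

end
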